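(* Let $m,n$ be positive integers with $m>n$, $m$ even and $n$ odd. Then, with the notation of the context, $$ \mathsf S^h_{m,n}=\begin{cases} \operatorname{graph}(F_{m,n})\cup\operatorname{graph}(-F_{m,n}) & \text{if } m\ge 2n,\\ \operatorname{graph}(G_{m,n})\cup\operatorname{graph}(-G_{m,n}) & \text{if } m\le 2n. \end{cases} $$
   Context: Norm: for integers $m>n\ge1$ and $(a,b,c)\in\mathbb R^3$, $|||(a,b,c)|||_{m,n}=\sup\{|ax^m+bx^{m-n}y^n+cy^m| : (x,y)\in[-1,1]^2\}$, and $\mathsf S^h_{m,n}=\{(a,b,c)\in\mathbb R^3: |||(a,b,c)|||_{m,n}=1\}$ is its unit sphere. Let $\Pi=\{(a,c)\in[-1,1]^2: |a+c|\le1\}$. For a function $F:\Pi\to\mathbb R$, $\operatorname{graph}(F)=\{(a,F(a,c),c): (a,c)\in\Pi\}\subset\mathbb R^3$ (the middle coordinate $b$ is the dependent one). For integers $m>n\ge 1$ let $J_{m,n}=\frac mn\left(\frac{n}{m-n}\right)^{\frac{m-n}{m}}$. Let $m$ be even, $n$ odd, $m\ge 2n$, and put $\lambda_0=\frac{n}{m-n}$, $a_0=\frac nm$. Consider the equation $$(\ast)\qquad J_{m,n}(1-a)^{\frac{m-n}{m}}|c|^{\frac nm}-1-a-c=0 .$$ Let $(a_1,c_1)$ be the unique point with $a_1\le 1$, $c_1<0$ satisfying $(\ast)$ and $c_1=\lambda_0a_1-1$; one has $a_0\le a_1<1$. For $a\in[a_0,a_1]$, let $\Gamma_{m,n}(a)$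 be the unique negative $c$ satisfying $(\ast)$. For $a\in[a_1,1]$ let $$\Upsilon_{m,n}(a)=-\frac{a^{\frac{m-n}{n}}}{(1-a)^{\frac{m-n}{n}}+a^{\frac{m-n}{n}}}.$$ Define $$U^1_{m,n}=\{(a,c)\in\Pi: a_0\le a\le a_1,\ \lambda_0(a-1)\ge c\ge\Gamma_{m,n}(a)\}\cup\{(a,c)\in\Pi: a_1\le a\le1,\ \lambda_0(a-1)\ge c\ge\Upsilon_{m,n}(a)\},$$ $$V^1_{m,n}=\{(a,c)\in\Pi: 0\le a\le a_1,\ -1\le c\le\lambda_0a-1\}\cup\{(a,c)\in\Pi: a_1\le a\le1,\ -1\le c\le\Upsilon_{m,n}(a)\},$$ $U^2_{m,n}=-U^1_{m,n}$, $V^2_{m,n}=-V^1_{m,n}$, $U_{m,n}=U^1_{m,n}\cup U^2_{m,n}$, $V_{m,n}=V^1_{m,n}\cup V^2_{m,n}$, $W_{m,n}=\Pi\setminus(U_{m,n}\cup V_{m,n})$. The function $F_{m,n}:\Pi\to\mathbb R$ (for $m\ge 2n$) is $$F_{m,n}(a,c)=\begin{cases} J_{m,n}(1-a)^{\frac{m-n}{m}}|c|^{\frac nm} & (a,c)\in U^1_{m,n},\\ J_{m,n}(1+a)^{\frac{m-n}{m}}c^{\frac nm} & (a,c)\in U^2_{m,n},\\ J_{m,m-n}(1+c)^{\frac nm}a^{\frac{m-n}{m}} & (a,c)\in V^1_{m,n},\\ J_{m,m-n}(1-c)^{\frac nm}|a|^{\frac{m-n}{m}} & (a,c)\in V^2_{m,n},\\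 1-|a+c| & (a,c)\in W_{m,n} \end{cases}$$ (the formulas agree where the regions overlap). For $m$ even, $n$ odd with $n<m\le 2n$, the function $G_{m,n}:\Pi\to\mathbb R$ is $G_{m,n}(a,c)=F_{m,m-n}(c,a)$ (note that $m-n$ is odd and $m\ge 2(m-n)$). *)

theory Defs
  imports "HOL-Analysis.Analysis"
begin

text \<open>
  Points \<open>(a, b, c)\<close> stand for the trinomials \<open>a x\<^sup>m + b x\<^sup>m\<^sup>-\<^sup>n y\<^sup>n + c y\<^sup>m\<close>, measured by the sup norm
  on the square \<open>[-1,1]\<^sup>2\<close>.
\<close>

definition tri_norm :: "nat \<Rightarrow> nat \<Rightarrow> real \<times> real \<times> real \<Rightarrow> real" where
  "tri_norm m n = (\<lambda>(a, b, c).
     (SUP (x, y) \<in> {-1..1} \<times> {-1..1}. \<bar>a * x ^ m + b * x ^ (m - n) * y ^ n + c * y ^ m\<bar>))"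

definition unit_sphere :: "nat \<Rightarrow> nat \<Rightarrow> (real \<times> real \<times> real) set" where
  "unit_sphere m n = {p. tri_norm m n p = 1}"

definition Pi_dom :: "(real \<times> real) set" where
  "Pi_dom = {(a, c). a \<in> {-1..1} \<and> c \<in> {-1..1} \<and> \<bar>a + c\<bar> \<le> 1}"

text \<open>
  A function on \<open>Pi_dom\<close> is represented by a total function of which only the values on \<open>Pi_dom\<close>
  matter. The dependent coordinate is the middle one.
\<close>

definition graph_Pi :: "(real \<Rightarrow> real \<Rightarrow> real) \<Rightarrow> (real \<times> real \<times> real) set" where
  "graph_Pi F = {(a, F a c, c) | a c. (a, c) \<in> Pi_dom}"

definition J :: "nat \<Rightarrow> nat \<Rightarrow> real" where
  "J m n = (real m / real n) *
     (real n / (real m - real n)) powr ((real m - real n) / real m)"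

definition lambda0 :: "nat \<Rightarrow> nat \<Rightarrow> real" where
  "lambda0 m n = real n / (real m - real n)"

definition a0 :: "nat \<Rightarrow> nat \<Rightarrow> real" where
  "a0 m n = real n / real m"

text \<open>
  The base \<open>1 - a\<close> is nonnegative wherever this is used (\<open>a \<le> 1\<close>).
\<close>

definition curve_eq :: "nat \<Rightarrow> nat \<Rightarrow> real \<Rightarrow> real \<Rightarrow> bool" where
  "curve_eq m n a c \<longleftrightarrow>
     J m n * (1 - a) powr ((real m - real n) / real m) * \<bar>c\<bar> powr (real n / real m)
       - 1 - a - c = 0"

definition corner :: "nat \<Rightarrow> nat \<Rightarrow> real \<times> real" where
  "corner m n = (THE (a, c). a \<le> 1 \<and> c < 0 \<and> curve_eq m n a c \<and> c = lambda0 m n * a - 1)"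

definition a1 :: "nat \<Rightarrow> nat \<Rightarrow> real" where
  "a1 m n = fst (corner m n)"

text \<open>
  \<open>Gam\<close> is meaningful for \<open>a0 \<le> a \<le> a1\<close> and \<open>Ups\<close> for \<open>a1 \<le> a \<le> 1\<close>; they are only used there.
\<close>

definition Gam :: "nat \<Rightarrow> nat \<Rightarrow> real \<Rightarrow> real" where
  "Gam m n a = (THE c. c < 0 \<and> curve_eq m n a c)"

definition Ups :: "nat \<Rightarrow> nat \<Rightarrow> real \<Rightarrow> real" where
  "Ups m n a =
     - (a powr ((real m - real n) / real n) /
        ((1 - a) powr ((real m - real n) / real n) + a powr ((real m - real n) / real n)))"

definition U1 :: "nat \<Rightarrow> nat \<Rightarrow> (real \<times> real) set" where
  "U1 m n =
     {(a, c) \<in> Pi_dom. a0 m n \<le> a \<and> a \<le> a1 m n \<and>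
        lambda0 m n * (a - 1) \<ge> c \<and> c \<ge> Gam m n a} \<union>
     {(a, c) \<in> Pi_dom. a1 m n \<le> a \<and> a \<le> 1 \<and>
        lambda0 m n * (a - 1) \<ge> c \<and> c \<ge> Ups m n a}"

definition V1 :: "nat \<Rightarrow> nat \<Rightarrow> (real \<times> real) set" where
  "V1 m n =
     {(a, c) \<in> Pi_dom. 0 \<le> a \<and> a \<le> a1 m n \<and> -1 \<le> c \<and> c \<le> lambda0 m n * a - 1} \<union>
     {(a, c) \<in> Pi_dom. a1 m n \<le> a \<and> a \<le> 1 \<and> -1 \<le> c \<and> c \<le> Ups m n a}"

definition U2 :: "nat \<Rightarrow> nat \<Rightarrow> (real \<times> real) set" where
  "U2 m n = uminus ` U1 m n"

definition V2 :: "nat \<Rightarrow> nat \<Rightarrow> (real \<times> real) set" where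
  "V2 m n = uminus ` V1 m n"

text \<open>
  The formulas agree where the regions overlap, so the order of the cases is immaterial. On
  \<open>Pi_dom\<close> the last case is exactly the complement \<open>W\<close> of the four regions.
\<close>

definition F :: "nat \<Rightarrow> nat \<Rightarrow> real \<Rightarrow> real \<Rightarrow> real" where
  "F m n a c =
    (if (a, c) \<in> U1 m n then
       J m n * (1 - a) powr ((real m - real n) / real m) * \<bar>c\<bar> powr (real n / real m)
     else if (a, c) \<in> U2 m n then
       J m n * (1 + a) powr ((real m - real n) / real m) * c powr (real n / real m)
     else if (a, c) \<in> V1 m n then
       J m (m - n) * (1 + c) powr (real n / real m) * a powr ((real m - real n) / real m)
     else if (a, c) \<in> V2 m n then
       J m (m - n) * (1 - c) powr (real n / real m) * \<bar>a\<bar> powr ((real m - real n) / real m)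
     else 1 - \<bar>a + c\<bar>)"

definition G :: "nat \<Rightarrow> nat \<Rightarrow> real \<Rightarrow> real \<Rightarrow> real" where
  "G m n a c = F m (m - n) c a"

end

theory Submission
  imports Defs
begin

text \<open>
  Put \<open>p = (m - n) / m\<close> and \<open>q = n / m\<close>. Since \<open>m\<close> is even and \<open>n\<close> odd, the norm of \<open>(a, b, c)\<close> is
  the maximum of \<open>\<bar>a X + c Y\<bar> + \<bar>b\<bar> X\<^sup>p Y\<^sup>q\<close> over \<open>X = \<bar>x\<bar>\<^sup>m\<close> and \<open>Y = \<bar>y\<bar>\<^sup>m\<close> in \<open>[0,1]\<close>. For given
  \<open>(a, c)\<close> at most one \<open>\<bar>b\<bar>\<close> makes it equal to \<open>1\<close>. If \<open>a\<close> and \<open>c\<close> have the same sign, this is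
  \<open>1 - \<bar>a + c\<bar>\<close>. If \<open>c = - d\<close> with \<open>a, d \<ge> 0\<close>, weighted AM-GM,
  \<open>(u / p)\<^sup>p (v / q)\<^sup>q \<le> u + v\<close>, shows that it is the minimum of \<open>1 - \<bar>a - d\<bar>\<close>, of the geometric mean
  of \<open>(1 - a, d)\<close> if \<open>q (1 - a) \<le> p d\<close> and of that of \<open>(a, 1 - d)\<close> if \<open>p (1 - d) \<le> q a\<close>. The curves
  \<open>Gam\<close> and \<open>Ups\<close> are where two of these three candidates coincide, and all three coincide at the
  corner.
\<close>

section \<open>Weighted geometric means and profiles\<close>

locale weights =
  fixes p q :: real
  assumes p_pos: "0 < p" and q_pos: "0 < q" and p_q: "p + q = 1"
begin

text \<open>For \<open>u, v \<ge> 0\<close> this is the largest \<open>k\<close> with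
  \<open>k X^p Y^q \<le> u X + v Y\<close> for all \<open>X, Y \<ge> 0\<close>.\<close>

definition geo :: "real \<Rightarrow> real \<Rightarrow> real" where
  "geo u v = (u / p) powr p * (v / q) powr q"

definition profile :: "real \<Rightarrow> real \<Rightarrow> real \<Rightarrow> real \<Rightarrow> real \<Rightarrow> real" where
  "profile a b c X Y = \<bar>a * X + c * Y\<bar> + b * (X powr p * Y powr q)"

text \<open>Norm one for a nonnegative middle coefficient, split into a bound and its attainment so
  that no supremum has to be handled.\<close>

definition extremal :: "real \<Rightarrow> real \<Rightarrow> real \<Rightarrow> bool" where
  "extremal a b c \<longleftrightarrow> 0 \<le> b \<and> (\<forall>X\<in>{0..1}. \<forall>Y\<in>{0..1}. profile a b c X Y \<le> 1)
     \<and> (\<exists>X\<in>{0..1}. \<exists>Y\<in>{0..1}. profile a b c X Y = 1)"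

lemma young:
  assumes "0 \<le> X" "0 \<le> Y"
  shows "X powr p * Y powr q \<le> p * X + q * Y"
proof (cases "X = 0 \<or> Y = 0")
  case True
  then show ?thesis using assms p_pos q_pos by auto
next
  case False
  then show ?thesis using Youngs_inequality_0[of p q X Y] assms p_pos q_pos p_q by simp
qed

lemma geo_nonneg: "0 \<le> geo u v"
  by (simp add: geo_def)

lemma geo_scale: "geo u v * (X powr p * Y powr q) = geo (u * X) (v * Y)"
  by (simp add: geo_def powr_mult powr_divide)

lemma geo_le_add:
  assumes "0 \<le> u" "0 \<le> v"
  shows "geo u v \<le> u + v"
  using young[of "u / p" "v / q"] assms p_pos q_pos by (simp add: geo_def)

text \<open>Equality case of weighted AM-GM: the arguments are in the ratio
  \<open>p : q\<close>.\<close>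

lemma geo_weights:
  assumes "0 \<le> w"
  shows "geo (p * w) (q * w) = w"
  using assms p_pos q_pos p_q by (cases "w = 0") (auto simp: geo_def powr_add[symmetric])

lemma geo_mono:
  assumes "0 \<le> u" "u \<le> u'" "0 \<le> v" "v \<le> v'"
  shows "geo u v \<le> geo u' v'"
  unfolding geo_def using assms p_pos q_pos
  by (intro mult_mono powr_mono2 divide_right_mono) auto

text \<open>Exchanging the two variables exchanges the weights, so interpreting the locale at
  \<open>q, p\<close> turns each one-sided lemma into its mirror image.\<close>

lemma swap: "weights q p"
  using p_pos q_pos p_q by unfold_locales auto

lemma geo_swap: "weights.geo q p v u = geo u v"
  unfolding geo_def weights.geo_def[OF swap] by (rule mult.commute)

lemma profile_swap: "weights.profile q p c b a Y X = profile a b c X Y"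
  unfolding profile_def weights.profile_def[OF swap] by (simp add: ac_simps)

lemma continuous_on_geo:
  assumes "continuous_on S f" "continuous_on S g" "\<And>x. x \<in> S \<Longrightarrow> 0 \<le> f x" "\<And>x. x \<in> S \<Longrightarrow> 0 \<le> g x"
  shows "continuous_on S (\<lambda>x. geo (f x) (g x))"
  unfolding geo_def using assms p_pos q_pos
  by (intro continuous_intros continuous_on_powr') auto

section \<open>Sign symmetry and sufficient conditions for extremality\<close>

lemma extremal_uminus: "extremal (- a) b (- c) \<longleftrightarrow> extremal a b c"
proof -
  have "profile (- a) b (- c) X Y = profile a b c X Y" for X Y
    unfolding profile_def using abs_minus_cancel[of "a * X + c * Y"] by simp
  then show ?thesis by (simp add: extremal_def)
qed

text \<open>
  The constraint \<open>a X - d Y + b X\<^sup>p Y\<^sup>q \<le> 1\<close> amounts to \<open>b \<le> geo (1 - a) d\<close> if the minimum of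
  \<open>((1 - a) X + d Y) / (X\<^sup>p Y\<^sup>q)\<close> is attained at a point with \<open>Y \<le> X\<close>; otherwise only its instance
  at \<open>X = Y = 1\<close> matters.
\<close>

lemma half_profile_le:
  assumes "0 \<le> a" "a \<le> 1" "0 \<le> d" "0 \<le> b" "b \<le> 1 - a + d"
    and "b \<le> geo (1 - a) d \<or> p * d \<le> q * (1 - a)"
    and "X \<in> {0..1}" "Y \<in> {0..1}"
  shows "a * X - d * Y + b * (X powr p * Y powr q) \<le> 1"
  using assms(6)
proof
  assume "b \<le> geo (1 - a) d"
  then have "b * (X powr p * Y powr q) \<le> geo (1 - a) d * (X powr p * Y powr q)"
    by (intro mult_right_mono) auto
  also have "\<dots> \<le> (1 - a) * X + d * Y"
    unfolding geo_scale using assms by (intro geo_le_add) auto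
  finally show ?thesis using assms by (simp add: algebra_simps)
next
  assume h: "p * d \<le> q * (1 - a)"
  \<comment> \<open>\<open>X^p Y^q\<close> is replaced by its tangent plane at
    \<open>(1, 1)\<close>. The resulting linear bound has nonnegative coefficients, so it is largest
    at \<open>X = Y = 1\<close>, where its value is 1.\<close>
  have "b * (X powr p * Y powr q) \<le> (1 - a + d) * (p * X + q * Y)"
    using assms young[of X Y] p_pos q_pos by (intro mult_mono) auto
  then have "a * X - d * Y + b * (X powr p * Y powr q)
      \<le> (a + p * (1 - a + d)) * X + (q * (1 - a + d) - d) * Y"
    by (simp add: algebra_simps)
  also have "\<dots> \<le> (a + p * (1 - a + d)) * 1 + (q * (1 - a + d) - d) * 1"
  proof -
    have "0 \<le> a + p * (1 - a + d)" using assms p_pos by simp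
    moreover have "0 \<le> q * (1 - a + d) - d"
    proof -
      have p: "p = 1 - q" using p_q by simp
      show ?thesis using h unfolding p by (simp add: algebra_simps)
    qed
    ultimately show ?thesis using assms by (intro add_mono mult_left_mono) auto
  qed
  also have "\<dots> = a - d + (p + q) * (1 - a + d)" by (simp add: algebra_simps)
  also have "\<dots> = 1" using p_q by simp
  finally show ?thesis .
qed

text \<open>On the edge \<open>X = 1\<close>, AM-GM for \<open>1 - a\<close> and \<open>d Y\<close>
  is an equality when \<open>p d Y = q (1 - a)\<close>; the last hypothesis puts this
  \<open>Y\<close> into the unit interval.\<close>

lemma half_profile_eq:
  assumes "a \<le> 1" "0 \<le> d" "q * (1 - a) \<le> p * d"
  obtains Y where "Y \<in> {0..1}" "a - d * Y + geo (1 - a) d * Y powr q = 1"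
proof (cases "d = 0")
  case True
  then have "a = 1" using assms q_pos by (simp add: mult_le_0_iff)
  then show ?thesis using that[of 0] True by (simp add: geo_def)
next
  case False
  define Y where "Y = q * (1 - a) / (p * d)"
  have pd: "p * d > 0" using False assms p_pos by simp
  have Y: "Y \<in> {0..1}" using assms pd q_pos by (simp add: Y_def)
  have dY: "d * Y = q * ((1 - a) / p)" using False p_pos by (simp add: Y_def field_simps)
  have "geo (1 - a) d * Y powr q = geo (1 - a) (d * Y)"
    using geo_scale[of "1 - a" d 1 Y] by simp
  also have "\<dots> = (1 - a) / p"
    using geo_weights[of "(1 - a) / p"] assms p_pos by (simp add: dY)
  also have "\<dots> = (p + q) * ((1 - a) / p)" by (simp add: p_q)
  also have "\<dots> = 1 - a + d * Y" using p_pos unfolding dY distrib_right by simp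
  finally have "a - d * Y + geo (1 - a) d * Y powr q = 1" by simp
  with Y that show ?thesis by blast
qed

text \<open>The two disjunctions before the last hypothesis bound the two signs of
  \<open>a X - d Y\<close>, each being the mirror image of the other. The last hypothesis says where
  1 is attained: at \<open>(1, 1)\<close>, on the edge \<open>X = 1\<close> or on the edge
  \<open>Y = 1\<close>.\<close>

lemma extremalI:
  assumes "0 \<le> a" "a \<le> 1" "0 \<le> d" "d \<le> 1" "0 \<le> b" "b \<le> 1 - \<bar>a - d\<bar>"
    and "b \<le> geo (1 - a) d \<or> p * d \<le> q * (1 - a)"
    and "b \<le> geo a (1 - d) \<or> p * d \<le> p - q * a"
    and "b = 1 - \<bar>a - d\<bar> \<or> b = geo (1 - a) d \<and> q * (1 - a) \<le> p * d
      \<or> b = geo a (1 - d) \<and> p - q * a \<le> p * d"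
  shows "extremal a b (- d)"
proof -
  interpret sw: weights q p by (rule swap)
  have le: "profile a b (- d) X Y \<le> 1" if "X \<in> {0..1}" "Y \<in> {0..1}" for X Y
  proof -
    have "a * X - d * Y + b * (X powr p * Y powr q) \<le> 1"
      using assms that by (intro half_profile_le) auto
    moreover have "d * Y - a * X + b * (Y powr q * X powr p) \<le> 1"
      using assms that
      by (intro sw.half_profile_le) (auto simp: geo_swap algebra_simps)
    ultimately show ?thesis
      by (auto simp: profile_def abs_if mult.commute)
  qed
  have ge: "\<exists>X\<in>{0..1}. \<exists>Y\<in>{0..1}. 1 \<le> profile a b (- d) X Y"
    using assms(9)
  proof (elim disjE conjE)
    assume "b = 1 - \<bar>a - d\<bar>"
    then have "profile a b (- d) 1 1 = 1" by (simp add: profile_def)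
    then show ?thesis by (intro bexI[of _ 1]) auto
  next
    assume "b = geo (1 - a) d" "q * (1 - a) \<le> p * d"
    moreover from this obtain Y where "Y \<in> {0..1}" "a - d * Y + geo (1 - a) d * Y powr q = 1"
      using half_profile_eq[of a d] assms by blast
    ultimately show ?thesis
      by (intro bexI[of _ 1] bexI[of _ Y]) (auto simp: profile_def)
  next
    assume b: "b = geo a (1 - d)" "p - q * a \<le> p * d"
    then have "p * (1 - d) \<le> q * a" by (simp add: algebra_simps)
    then obtain X where "X \<in> {0..1}" "d - a * X + geo a (1 - d) * X powr p = 1"
      using sw.half_profile_eq[of d a] assms by (auto simp: geo_swap)
    then show ?thesis
      by (intro bexI[of _ X] bexI[of _ 1]) (auto simp: b profile_def)
  qed
  then obtain X Y where XY: "X \<in> {0..1}" "Y \<in> {0..1}" "1 \<le> profile a b (- d) X Y"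
    by blast
  with le have "profile a b (- d) X Y = 1" by (intro antisym)
  with XY le show ?thesis unfolding extremal_def using assms(5) by blast
qed

text \<open>Without cancellation every term of the profile is largest at
  \<open>X = Y = 1\<close>.\<close>

lemma extremal_same_sign:
  assumes "0 \<le> a" "0 \<le> c" "a + c \<le> 1"
  shows "extremal a (1 - (a + c)) c"
proof -
  have le: "profile a (1 - (a + c)) c X Y \<le> 1" if "X \<in> {0..1}" "Y \<in> {0..1}" for X Y
  proof -
    have "a * X \<le> a * 1" "c * Y \<le> c * 1"
      using assms that by (simp_all add: mult_left_le)
    moreover have "X powr p * Y powr q \<le> 1"
      using that p_pos q_pos by (intro mult_le_one powr_le1) auto
    then have "(1 - (a + c)) * (X powr p * Y powr q) \<le> (1 - (a + c)) * 1"
      using assms by (intro mult_left_mono) auto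
    moreover have "0 \<le> a * X" "0 \<le> c * Y" using assms that by auto
    ultimately show ?thesis by (simp add: profile_def)
  qed
  moreover have "profile a (1 - (a + c)) c 1 1 = 1"
    using assms by (simp add: profile_def)
  then have "\<exists>X\<in>{0..1}. \<exists>Y\<in>{0..1}. profile a (1 - (a + c)) c X Y = 1"
    by (intro bexI[of _ 1]) auto
  ultimately show ?thesis using assms by (simp add: extremal_def)
qed

section \<open>Uniqueness of the extremal coefficient\<close>

lemma extremal_bounds:
  assumes "extremal a b c"
  shows "\<bar>a\<bar> \<le> 1" "\<bar>c\<bar> \<le> 1" "\<bar>a + c\<bar> \<le> 1"
proof -
  have *: "profile a b c X Y \<le> 1" if "X \<in> {0..1}" "Y \<in> {0..1}" for X Y
    using assms that by (auto simp: extremal_def)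
  show "\<bar>a\<bar> \<le> 1" using *[of 1 0] by (simp add: profile_def)
  show "\<bar>c\<bar> \<le> 1" using *[of 0 1] by (simp add: profile_def)
  show "\<bar>a + c\<bar> \<le> 1"
    using *[of 1 1] assms by (simp add: profile_def extremal_def)
qed

lemma nonpos_if_le_powr:
  fixes b r :: real
  assumes "0 < r" "\<And>t. 0 < t \<Longrightarrow> t \<le> 1 \<Longrightarrow> b \<le> t powr r"
  shows "b \<le> 0"
proof (rule ccontr)
  assume "\<not> b \<le> 0"
  then have b: "0 < b" "b \<le> 1" using assms(2)[of 1] by auto
  define t where "t = (b / 2) powr (1 / r)"
  have "t powr r = b / 2" using assms(1) b by (simp add: t_def powr_powr)
  moreover have "0 < t" "t \<le> 1" using b assms(1) by (auto simp: t_def intro!: powr_le1)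
  ultimately show False using assms(2)[of t] b by simp
qed

text \<open>As \<open>Y\<close> tends to 0, the absolute value falls below 1 by at most
  \<open>Y\<close>, while the middle term is of the larger order \<open>Y^q\<close>.\<close>

lemma profile_le_imp_nonpos:
  assumes "\<bar>a\<bar> = 1" "\<bar>c\<bar> \<le> 1" and "\<And>Y. Y \<in> {0..1} \<Longrightarrow> profile a b c 1 Y \<le> 1"
  shows "b \<le> 0"
proof (rule nonpos_if_le_powr[OF p_pos])
  fix Y :: real assume Y: "0 < Y" "Y \<le> 1"
  have "\<bar>c * Y\<bar> \<le> 1 * Y" unfolding abs_mult using assms Y by (intro mult_mono) auto
  moreover have "\<bar>a + c * Y\<bar> + b * Y powr q \<le> 1"
    using assms(3)[of Y] Y by (simp add: profile_def)
  ultimately have "b * Y powr q \<le> Y" using assms(1) by linarith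
  then have "b \<le> Y / Y powr q" using Y by (simp add: field_simps)
  also have "Y / Y powr q = Y powr (1 - q)" using Y by (simp add: powr_diff)
  also have "1 - q = p" using p_q by simp
  finally show "b \<le> Y powr p" .
qed

text \<open>
  The coefficient \<open>b\<close> is strictly felt at every point with \<open>X, Y > 0\<close>. A profile attaining \<open>1\<close> at
  the boundary has \<open>\<bar>a\<bar> = 1\<close> or \<open>\<bar>c\<bar> = 1\<close>, and then \<open>b = 0\<close> by looking near that boundary point.
\<close>

lemma extremal_not_less:
  assumes "extremal a b c" "extremal a b' c"
  shows "\<not> b < b'"
proof
  assume less: "b < b'"
  interpret sw: weights q p by (rule swap)
  have b: "0 \<le> b" using assms by (simp add: extremal_def)
  have le: "profile a b' c X Y \<le> 1" if "X \<in> {0..1}" "Y \<in> {0..1}" for X Y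
    using assms that by (auto simp: extremal_def)
  obtain X Y where XY: "X \<in> {0..1}" "Y \<in> {0..1}" "profile a b c X Y = 1"
    using assms by (auto simp: extremal_def)
  note bd = extremal_bounds[OF assms(1)]
  have "\<bar>a\<bar> \<noteq> 1"
    using profile_le_imp_nonpos[of a c b'] bd le less b by force
  moreover have "\<bar>c\<bar> \<noteq> 1"
    using sw.profile_le_imp_nonpos[of c a b'] bd le less b by (force simp: profile_swap)
  ultimately have ac: "\<bar>a\<bar> < 1" "\<bar>c\<bar> < 1" using bd by auto
  have "X \<noteq> 0"
  proof
    assume "X = 0"
    then have "\<bar>c\<bar> * Y = 1" using XY by (simp add: profile_def abs_mult)
    moreover have "\<bar>c\<bar> * Y \<le> \<bar>c\<bar> * 1" using XY by (intro mult_left_mono) auto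
    ultimately show False using ac by simp
  qed
  moreover have "Y \<noteq> 0"
  proof
    assume "Y = 0"
    then have "\<bar>a\<bar> * X = 1" using XY by (simp add: profile_def abs_mult)
    moreover have "\<bar>a\<bar> * X \<le> \<bar>a\<bar> * 1" using XY by (intro mult_left_mono) auto
    ultimately show False using ac by simp
  qed
  ultimately have "b * (X powr p * Y powr q) < b' * (X powr p * Y powr q)"
    using less XY by (intro mult_strict_right_mono) auto
  then have "profile a b c X Y < profile a b' c X Y" by (simp add: profile_def)
  then show False using XY le[of X Y] by simp
qed

lemma extremal_unique: "extremal a b c \<Longrightarrow> extremal a b' c \<Longrightarrow> b = b'"
  using extremal_not_less[of a b c b'] extremal_not_less[of a b' c b] by linarith

end


section \<open>The curves \<open>Gam\<close> and \<open>Ups\<close> and the corner\<close>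

locale trinomial = weights +
  fixes m n :: nat
  assumes n_pos: "0 < n" and n_less: "n < m"
    and p_eq: "p = (real m - real n) / real m" and q_eq: "q = real n / real m"
begin

text \<open>\<open>J m n\<close> and \<open>J m (m - n)\<close> both equal
  \<open>1 / (p^p q^q)\<close>, so each formula with \<open>J\<close> in \<open>F\<close> is a value
  of \<open>geo\<close>.\<close>

lemma J_powr: "J m n * u powr p * v powr q = geo u v"
proof -
  have "J m n = 1 / q * (q / p) powr p"
    using n_pos n_less by (simp add: J_def p_eq q_eq)
  also have "\<dots> = q powr (p - 1) / p powr p"
    using q_pos by (simp add: powr_divide powr_diff)
  also have "p - 1 = - q" using p_q by simp
  finally show ?thesis
    by (simp add: geo_def powr_divide powr_minus_divide mult_ac)
qed

lemma J_diff_powr: "J m (m - n) * v powr q * u powr p = geo u v"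
proof -
  have "J m (m - n) = 1 / p * (p / q) powr q"
    using n_pos n_less by (simp add: J_def p_eq q_eq of_nat_diff)
  also have "\<dots> = p powr (q - 1) / q powr q"
    using p_pos by (simp add: powr_divide powr_diff)
  also have "q - 1 = - p" using p_q by simp
  finally show ?thesis
    by (simp add: geo_def powr_divide powr_minus_divide mult_ac)
qed

lemma lambda0_eq: "lambda0 m n = q / p"
  using n_pos n_less by (simp add: lambda0_def p_eq q_eq)

lemma a0_eq: "a0 m n = q"
  by (simp add: a0_def q_eq)

lemma curve_eq_iff: "curve_eq m n a c \<longleftrightarrow> geo (1 - a) \<bar>c\<bar> = 1 + a + c"
  unfolding curve_eq_def p_eq[symmetric] q_eq[symmetric] J_powr by auto

lemma one_plus: "1 + q / p = 1 / p"
  using p_pos p_q by (simp add: field_simps)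

text \<open>With \<open>c = - d\<close> the curve equation reads
  \<open>geo (1 - a) d + d = 1 + a\<close>. Its left side is strictly increasing in
  \<open>d\<close>, which gives the unique root and the comparison with it.\<close>

lemma Gam_le_iff:
  assumes "0 \<le> a" "a < 1" "0 \<le> d"
  shows "Gam m n a \<le> - d \<longleftrightarrow> geo (1 - a) d \<le> 1 + a - d"
proof -
  define g where "g d = geo (1 - a) d + d" for d
  have mono: "g d < g d'" if "0 \<le> d" "d < d'" for d d'
    using that assms geo_mono[of "1 - a" "1 - a" d d'] by (simp add: g_def)
  have "continuous_on {0..1 + a} g"
    unfolding g_def using assms
    by (intro continuous_intros continuous_on_geo) auto
  moreover have "g 0 \<le> 1 + a" using assms by (simp add: g_def geo_def)
  moreover have "1 + a \<le> g (1 + a)" using geo_nonneg by (simp add: g_def)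
  ultimately obtain d0 where d0: "0 \<le> d0" "g d0 = 1 + a"
    using IVT'[of g 0 "1 + a" "1 + a"] assms by auto
  then have "d0 \<noteq> 0" using assms by (auto simp: g_def geo_def)
  have "Gam m n a = - d0"
    unfolding Gam_def
  proof (rule the_equality)
    show "- d0 < 0 \<and> curve_eq m n a (- d0)"
      using d0 \<open>d0 \<noteq> 0\<close> by (simp add: curve_eq_iff g_def)
  next
    fix c assume c: "c < 0 \<and> curve_eq m n a c"
    then have "g (- c) = g d0" using d0 by (auto simp: curve_eq_iff g_def)
    then show "c = - d0"
      using mono[of "- c" d0] mono[of d0 "- c"] c d0 by linarith
  qed
  moreover have "d \<le> d0 \<longleftrightarrow> g d \<le> g d0"
    using mono[of d d0] mono[of d0 d] assms d0 by (cases d d0 rule: linorder_cases) auto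
  ultimately show ?thesis using d0 by (auto simp: g_def)
qed

text \<open>The power \<open>1 / q\<close> makes \<open>geo\<close> linear in its second argument up
  to a constant factor; hence the exponent \<open>p / q\<close> in \<open>Ups\<close>.\<close>

lemma geo_le_iff:
  assumes "0 \<le> v" "0 \<le> v'"
  shows "geo u v \<le> geo u' v' \<longleftrightarrow> u powr (p / q) * v \<le> u' powr (p / q) * v'"
proof -
  define k where "k = p powr p * q powr q"
  have k: "k > 0" using p_pos q_pos by (simp add: k_def)
  have eq: "geo u v = (u powr (p / q) * v) powr q / k" for u v
    using q_pos by (simp add: geo_def k_def powr_mult powr_divide powr_powr)
  have "x powr q \<le> y powr q \<longleftrightarrow> x \<le> y" if "0 \<le> x" "0 \<le> y" for x y :: real
    using that q_pos powr_less_mono2[of q y x] powr_mono2[of q x y] by linarith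
  then show ?thesis
    unfolding eq using k assms by (simp add: divide_le_cancel)
qed

text \<open>By \<open>geo_le_iff\<close> the comparison is linear in \<open>d\<close>, and the two
  means agree exactly at \<open>d = - Ups m n a\<close>.\<close>

lemma Ups_le_iff:
  assumes "0 < a" "0 \<le> d" "d \<le> 1"
  shows "Ups m n a \<le> - d \<longleftrightarrow> geo (1 - a) d \<le> geo a (1 - d)"
    and "- d \<le> Ups m n a \<longleftrightarrow> geo a (1 - d) \<le> geo (1 - a) d"
proof -
  have r: "(real m - real n) / real n = p / q"
    using n_pos n_less by (simp add: p_eq q_eq)
  define A B where "A = a powr (p / q)" and "B = (1 - a) powr (p / q)"
  have "0 < B + A" using assms by (simp add: A_def B_def add_nonneg_pos)
  moreover have Ups: "Ups m n a = - (A / (B + A))" by (simp add: Ups_def r A_def B_def)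
  ultimately have 1: "Ups m n a \<le> - d \<longleftrightarrow> B * d \<le> A * (1 - d)"
    and 2: "- d \<le> Ups m n a \<longleftrightarrow> A * (1 - d) \<le> B * d"
    unfolding Ups by (simp_all add: field_simps)
  show "Ups m n a \<le> - d \<longleftrightarrow> geo (1 - a) d \<le> geo a (1 - d)"
    and "- d \<le> Ups m n a \<longleftrightarrow> geo a (1 - d) \<le> geo (1 - a) d"
    using assms by (simp_all add: geo_le_iff 1 2 A_def B_def)
qed

lemma Ups_neg: "0 < a \<Longrightarrow> Ups m n a < 0"
  by (simp add: Ups_def add_nonneg_pos)

text \<open>On the line \<open>c = q / p * a - 1\<close> the curve equation becomes
  \<open>geo (1 - a) (1 - q / p * a) = a / p\<close>. The difference of the two sides strictly
  decreases on the unit interval, from positive to negative, and \<open>a1\<close> is its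
  zero.\<close>

lemma corner_props:
  assumes "q \<le> p"
  shows "0 < a1 m n" "a1 m n < 1"
    and "0 \<le> a \<Longrightarrow> a \<le> a1 m n \<Longrightarrow> a / p \<le> geo (1 - a) (1 - q / p * a)"
    and "a1 m n \<le> a \<Longrightarrow> a \<le> 1 \<Longrightarrow> geo (1 - a) (1 - q / p * a) \<le> a / p"
proof -
  define g where "g a = geo (1 - a) (1 - q / p * a) - a / p" for a
  have l: "0 < q / p" "q / p \<le> 1" using assms p_pos q_pos by auto
  have l1: "q / p * a \<le> 1" if "0 \<le> a" "a \<le> 1" for a
    using mult_le_one[of "q / p" a] l that by simp
  have mono: "g a' < g a" if "0 \<le> a" "a < a'" "a' \<le> 1" for a a'
  proof -
    have "q / p * a \<le> q / p * a'" using l that by (intro mult_left_mono) auto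
    then have "geo (1 - a') (1 - q / p * a') \<le> geo (1 - a) (1 - q / p * a)"
      using that l1[of a'] by (intro geo_mono) auto
    moreover have "a / p < a' / p" using that p_pos by (simp add: divide_strict_right_mono)
    ultimately show ?thesis by (simp add: g_def)
  qed
  have "continuous_on {0..1} g"
    unfolding g_def using l1 p_pos by (intro continuous_intros continuous_on_geo) auto
  moreover have g0: "0 < g 0" using p_pos q_pos by (simp add: g_def geo_def)
  moreover have g1: "g 1 < 0" using p_pos by (simp add: g_def geo_def)
  ultimately obtain t where t: "0 \<le> t" "t \<le> 1" "g t = 0"
    using IVT2'[of g 1 0 0] by auto
  then have "t \<noteq> 0" "t \<noteq> 1" using g0 g1 by auto
  with t have t01: "0 < t" "t < 1" by auto
  have unique: "a = t" if "0 \<le> a" "a \<le> 1" "g a = 0" for a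
    using mono[of a t] mono[of t a] that t by linarith
  have curve: "curve_eq m n a (q / p * a - 1) \<longleftrightarrow> g a = 0" if "q / p * a - 1 < 0" for a
  proof -
    have "1 + a + (q / p * a - 1) = (1 + q / p) * a" by (simp add: algebra_simps)
    then show ?thesis using that by (simp add: curve_eq_iff g_def one_plus)
  qed
  have "corner m n = (t, q / p * t - 1)"
    unfolding corner_def
  proof (rule the_equality)
    have "q / p * t \<le> 1 * t" using l t01 by (intro mult_right_mono) auto
    then have "q / p * t - 1 < 0" using t01 by linarith
    then show "case (t, q / p * t - 1) of (a, c) \<Rightarrow>
        a \<le> 1 \<and> c < 0 \<and> curve_eq m n a c \<and> c = lambda0 m n * a - 1"
      using curve[of t] t by (simp add: lambda0_eq)
  next
    fix z :: "real \<times> real"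
    assume "case z of (a, c) \<Rightarrow> a \<le> 1 \<and> c < 0 \<and> curve_eq m n a c \<and> c = lambda0 m n * a - 1"
    then obtain a c where z: "z = (a, c)" "a \<le> 1" "c < 0" "curve_eq m n a c" "c = q / p * a - 1"
      by (cases z) (auto simp: lambda0_eq)
    then have "g a = 0" using curve[of a] by simp
    \<comment> \<open>The description of the corner bounds \<open>a\<close> only from above; the
      lower bound 0 comes from \<open>geo\<close> being nonnegative.\<close>
    then have "a / p \<ge> 0" using geo_nonneg[of "1 - a" "1 - q / p * a"] by (simp add: g_def)
    then have "a \<ge> 0" using p_pos by (simp add: zero_le_divide_iff)
    then show "z = (t, q / p * t - 1)" using unique[of a] z \<open>g a = 0\<close> by simp
  qed
  then have a1: "a1 m n = t" by (simp add: a1_def)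
  show "0 < a1 m n" "a1 m n < 1" using t01 a1 by auto
  show "a / p \<le> geo (1 - a) (1 - q / p * a)" if "0 \<le> a" "a \<le> a1 m n"
    using mono[of a t] that t01 t unfolding a1 by (cases "a = t") (auto simp: g_def)
  show "geo (1 - a) (1 - q / p * a) \<le> a / p" if "a1 m n \<le> a" "a \<le> 1"
    using mono[of t a] that t01 t unfolding a1 by (cases "a = t") (auto simp: g_def)
qed

section \<open>The regions and extremality of \<open>F\<close>\<close>

lemma U1_iff:
  "(a, c) \<in> U1 m n \<longleftrightarrow> (a, c) \<in> Pi_dom \<and> q * (1 - a) \<le> p * (- c) \<and>
     (q \<le> a \<and> a \<le> a1 m n \<and> Gam m n a \<le> c \<or> a1 m n \<le> a \<and> a \<le> 1 \<and> Ups m n a \<le> c)"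
proof -
  have "c \<le> lambda0 m n * (a - 1) \<longleftrightarrow> q * (1 - a) \<le> p * (- c)"
    using p_pos by (simp add: lambda0_eq field_simps)
  then show ?thesis by (auto simp: U1_def a0_eq)
qed

lemma V1_iff:
  "(a, c) \<in> V1 m n \<longleftrightarrow> (a, c) \<in> Pi_dom \<and> - 1 \<le> c \<and>
     (0 \<le> a \<and> a \<le> a1 m n \<and> p - q * a \<le> p * (- c) \<or> a1 m n \<le> a \<and> a \<le> 1 \<and> c \<le> Ups m n a)"
proof -
  have "c \<le> lambda0 m n * a - 1 \<longleftrightarrow> p - q * a \<le> p * (- c)"
    using p_pos by (simp add: lambda0_eq field_simps)
  then show ?thesis by (auto simp: V1_def)
qed


text \<open>Left of the corner, \<open>Gam\<close> gives the bound \<open>1 + a - d\<close> and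
  keeps the point where the other mean imposes nothing. Right of it, \<open>Ups\<close> compares
  with the other mean, which AM-GM bounds by \<open>1 + a - d\<close>.\<close>

lemma extremal_U:
  assumes "q \<le> p" "(a, - d) \<in> U1 m n"
  shows "extremal a (geo (1 - a) d) (- d)"
proof -
  note corner = corner_props[OF assms(1)]
  have pos: "0 < a"
    using assms corner(1) q_pos by (auto simp: U1_iff)
  have d: "q * (1 - a) \<le> p * d" and a1: "a \<le> 1" and d1: "d \<le> 1"
    using assms(2) by (auto simp: U1_iff Pi_dom_def)
  have "0 \<le> q * (1 - a)" using a1 q_pos by simp
  then have "0 \<le> p * d" using d by linarith
  then have d0: "0 \<le> d" using p_pos by (simp add: zero_le_mult_iff)
  have up: "geo (1 - a) d \<le> 1 - a + d" using geo_le_add[of "1 - a" d] a1 d0 by simp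
  have "geo (1 - a) d \<le> 1 + a - d \<and> (geo (1 - a) d \<le> geo a (1 - d) \<or> p * d \<le> p - q * a)"
  proof -
    consider "a \<le> a1 m n" "Gam m n a \<le> - d" | "a1 m n \<le> a" "Ups m n a \<le> - d"
      using assms(2) by (auto simp: U1_iff)
    then show ?thesis
    proof cases
      case 1
      then have le: "geo (1 - a) d \<le> 1 + a - d"
        using Gam_le_iff[of a d] corner(2) pos d0 by simp
      moreover have "p * d \<le> p - q * a"
      \<comment> \<open>Otherwise monotonicity and the corner inequality give
        \<open>a / p \<le> geo (1 - a) d \<le> 1 + a - d\<close>, but
        \<open>d > 1 - q / p * a\<close> makes the last term smaller than
        \<open>a / p\<close>.\<close>
      proof (rule ccontr)
        assume "\<not> p * d \<le> p - q * a"
        then have less: "1 - q / p * a < d" using p_pos by (simp add: field_simps)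
        have "q / p * a \<le> 1"
          using mult_le_one[of "q / p" a] assms(1) p_pos q_pos pos a1 by simp
        then have "geo (1 - a) (1 - q / p * a) \<le> geo (1 - a) d"
          using less a1 by (intro geo_mono) auto
        then have "(1 + q / p) * a \<le> 1 + a - d"
          using corner(3)[of a] 1 pos le by (simp add: one_plus)
        then show False using less by (simp add: algebra_simps)
      qed
      ultimately show ?thesis by simp
    next
      case 2
      then show ?thesis
        using Ups_le_iff(1)[of a d] geo_le_add[of a "1 - d"] pos d0 d1 by simp
    qed
  qed
  then show ?thesis
    using up pos a1 d d0 d1 geo_nonneg by (intro extremalI) auto
qed

text \<open>Left of the corner, monotonicity in \<open>d\<close> reduces the comparison of the two
  means to the line \<open>d = 1 - q / p * a\<close>, where \<open>corner_props\<close> decides it.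
  Right of it, \<open>Ups\<close> decides it directly.\<close>

lemma extremal_V:
  assumes "q \<le> p" "(a, - d) \<in> V1 m n"
  shows "extremal a (geo a (1 - d)) (- d)"
proof -
  note corner = corner_props[OF assms(1)]
  have a0: "0 \<le> a" and a1: "a \<le> 1" and d1: "d \<le> 1"
    using assms corner(1) corner(2) by (auto simp: V1_iff)
  have l1: "q / p * a \<le> 1"
    using mult_le_one[of "q / p" a] assms(1) p_pos q_pos a0 a1 by simp
  have line: "geo a (1 - (1 - q / p * a)) = a / p"
    using geo_weights[of "a / p"] a0 p_pos by simp
  have "geo a (1 - d) \<le> geo (1 - a) d \<and> p - q * a \<le> p * d"
  proof -
    consider "a \<le> a1 m n" "p - q * a \<le> p * d" | "a1 m n \<le> a" "- d \<le> Ups m n a"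
      using assms(2) by (auto simp: V1_iff)
    then show ?thesis
    proof cases
      case 1
      then have less: "1 - q / p * a \<le> d" using p_pos by (simp add: field_simps)
      have "geo a (1 - d) \<le> geo a (1 - (1 - q / p * a))"
        using a0 d1 less by (intro geo_mono) auto
      also have "\<dots> \<le> geo (1 - a) (1 - q / p * a)"
        unfolding line using corner(3)[of a] 1 a0 by simp
      also have "\<dots> \<le> geo (1 - a) d"
        using less a1 l1 by (intro geo_mono) auto
      finally show ?thesis using 1 by simp
    next
      case 2
      then have pos: "0 < a" using corner(1) by simp
      \<comment> \<open>Right of the corner the curve \<open>Ups\<close> lies on or below the line,
        so points below the curve satisfy the line condition too.\<close>
      have "geo (1 - a) (1 - q / p * a) \<le> geo a (1 - (1 - q / p * a))"
        unfolding line using corner(4)[of a] 2 a1 by simp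
      then have "Ups m n a \<le> - (1 - q / p * a)"
        using Ups_le_iff(1)[of a "1 - q / p * a"] pos l1 p_pos q_pos by simp
      with 2 have "1 - q / p * a \<le> d" by simp
      moreover from this have "0 \<le> d" using l1 by simp
      ultimately show ?thesis
        using Ups_le_iff(2)[of a d] 2 pos d1 p_pos by (simp add: field_simps)
    qed
  qed
  moreover have d0: "0 \<le> d"
  proof -
    have "0 \<le> p - q * a" using l1 p_pos by (simp add: field_simps)
    then have "0 \<le> p * d" using calculation by linarith
    then show ?thesis using p_pos by (simp add: zero_le_mult_iff)
  qed
  ultimately show ?thesis
    using geo_le_add[of a "1 - d"] geo_le_add[of "1 - a" d] a0 a1 d1 geo_nonneg
    by (intro extremalI) auto
qed

text \<open>If \<open>p * d \<le> q * (1 - a)\<close>, neither mean imposes a constraint. Otherwise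
  the point lies left of the corner, since right of it \<open>U1\<close> and \<open>V1\<close> meet
  along \<open>Ups\<close> and leave no gap.\<close>

lemma extremal_W:
  assumes "q \<le> p" "0 \<le> a" "a \<le> 1" "0 \<le> d" "d \<le> 1"
    and "(a, - d) \<notin> U1 m n" "(a, - d) \<notin> V1 m n"
  shows "extremal a (1 - \<bar>a - d\<bar>) (- d)"
proof -
  note corner = corner_props[OF assms(1)]
  have Pi: "(a, - d) \<in> Pi_dom" using assms by (simp add: Pi_dom_def)
  have "(1 - \<bar>a - d\<bar> \<le> geo (1 - a) d \<or> p * d \<le> q * (1 - a)) \<and> p * d \<le> p - q * a"
  proof (cases "p * d \<le> q * (1 - a)")
    case True
    then show ?thesis using assms(1) by (simp add: algebra_simps)
  next
    case False
    then have "\<not> a1 m n \<le> a" using assms(3,5-) Pi by (auto simp: U1_iff V1_iff)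
    then have a: "a < a1 m n" by simp
    then have "p * d \<le> p - q * a" using assms Pi by (auto simp: V1_iff)
    moreover have "1 - \<bar>a - d\<bar> \<le> geo (1 - a) d"
    proof (cases "q \<le> a")
      case True
      then have "\<not> Gam m n a \<le> - d" using assms a Pi False by (auto simp: U1_iff)
      then show ?thesis using Gam_le_iff[of a d] a corner(2) assms by simp
    next
      case 2: False
      \<comment> \<open>Left of \<open>a0\<close> the mean already exceeds 1: for
        \<open>d = q / p * (1 - a)\<close> it equals \<open>(1 - a) / p\<close>, and here
        \<open>1 - a > p\<close>.\<close>
      have d: "q / p * (1 - a) < d" using False p_pos by (simp add: field_simps)
      have "a \<le> q / p * (1 - a)"
      proof -
        have "a * (p + q) \<le> q" using 2 p_q by simp
        then show ?thesis using p_pos by (simp add: field_simps)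
      qed
      moreover have "geo (1 - a) (q / p * (1 - a)) = (1 + q / p) * (1 - a)"
        using geo_weights[of "(1 - a) / p"] assms(3) p_pos by (simp add: one_plus)
      moreover have "geo (1 - a) (q / p * (1 - a)) \<le> geo (1 - a) d"
        using d assms p_pos q_pos by (intro geo_mono) auto
      ultimately show ?thesis using d by (simp add: algebra_simps)
    qed
    ultimately show ?thesis by simp
  qed
  then show ?thesis
    using assms by (intro extremalI) auto
qed

text \<open>With \<open>V1_signs\<close>, the strict inequalities make \<open>U1\<close> and
  \<open>V1\<close> disjoint from the negatives of both, so the cases of \<open>F\<close> for a
  point and for its negative never compete.\<close>

lemma U1_signs: "q \<le> p \<Longrightarrow> (a, c) \<in> U1 m n \<Longrightarrow> 0 < a \<and> c \<le> 0"
proof -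
  assume A: "q \<le> p" "(a, c) \<in> U1 m n"
  have "0 < a" using A corner_props(1) q_pos by (auto simp: U1_iff)
  moreover have "0 \<le> q * (1 - a)" using A q_pos by (auto simp: U1_iff Pi_dom_def)
  then have "0 \<le> p * (- c)" using A(2) unfolding U1_iff by linarith
  then have "c \<le> 0" using p_pos by (simp add: mult_le_0_iff)
  ultimately show ?thesis by simp
qed

lemma V1_signs: "q \<le> p \<Longrightarrow> (a, c) \<in> V1 m n \<Longrightarrow> 0 \<le> a \<and> c < 0"
proof -
  assume A: "q \<le> p" "(a, c) \<in> V1 m n"
  note corner = corner_props[OF A(1)]
  consider "0 \<le> a" "a \<le> a1 m n" "p - q * a \<le> p * (- c)" | "a1 m n \<le> a" "c \<le> Ups m n a"
    using A(2) by (auto simp: V1_iff)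
  then show ?thesis
  proof cases
    case 1
    have "q * a < p * 1"
      using A(1) 1 corner(2) q_pos by (intro mult_le_less_imp_less) auto
    then have "0 < p * (- c)" using 1 by linarith
    then show ?thesis using 1 p_pos by (simp add: mult_less_0_iff)
  next
    case 2
    then show ?thesis using Ups_neg[of a] corner(1) by simp
  qed
qed

lemma U2_iff: "(a, c) \<in> U2 m n \<longleftrightarrow> (- a, - c) \<in> U1 m n"
  by (force simp: U2_def image_iff)

lemma V2_iff: "(a, c) \<in> V2 m n \<longleftrightarrow> (- a, - c) \<in> V1 m n"
  by (force simp: V2_def image_iff)

lemma F_eq:
  assumes "q \<le> p"
  shows "F m n a c =
    (if (a, c) \<in> U1 m n then geo (1 - a) (- c)
     else if (- a, - c) \<in> U1 m n then geo (1 + a) c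
     else if (a, c) \<in> V1 m n then geo a (1 + c)
     else if (- a, - c) \<in> V1 m n then geo (- a) (1 - c)
     else 1 - \<bar>a + c\<bar>)"
  using U1_signs[OF assms, of a c] V1_signs[OF assms, of "- a" "- c"]
  unfolding F_def U2_iff V2_iff p_eq[symmetric] q_eq[symmetric] J_powr J_diff_powr by auto

lemma F_uminus:
  assumes "q \<le> p"
  shows "F m n (- a) (- c) = F m n a c"
  using U1_signs[OF assms, of a c] U1_signs[OF assms, of "- a" "- c"]
    V1_signs[OF assms, of a c] V1_signs[OF assms, of "- a" "- c"]
  unfolding F_eq[OF assms] by (auto simp: abs_minus_commute)

lemma extremal_F:
  assumes "q \<le> p" "(a, c) \<in> Pi_dom"
  shows "extremal a (F m n a c) c"
proof -
  have opp: "extremal a (F m n a c) c" if "0 \<le> a" "c \<le> 0" "(a, c) \<in> Pi_dom" for a c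
    using that extremal_U[OF assms(1), of a "- c"] extremal_V[OF assms(1), of a "- c"]
      extremal_W[OF assms(1), of a "- c"] U1_signs[OF assms(1), of "- a" "- c"]
      V1_signs[OF assms(1), of "- a" "- c"]
    unfolding F_eq[OF assms(1)] by (auto simp: Pi_dom_def)
  have same: "extremal a (F m n a c) c" if "0 < a" "0 < c" "(a, c) \<in> Pi_dom" for a c
    using that extremal_same_sign[of a c] U1_signs[OF assms(1), of a c]
      V1_signs[OF assms(1), of a c] U1_signs[OF assms(1), of "- a" "- c"]
      V1_signs[OF assms(1), of "- a" "- c"]
    unfolding F_eq[OF assms(1)] by (auto simp: Pi_dom_def)
  have neg: "(- a, - c) \<in> Pi_dom"
    using assms(2) by (auto simp: Pi_dom_def)
  consider "0 \<le> a" "c \<le> 0" | "0 < a" "0 < c" | "a \<le> 0" "0 \<le> c" | "a < 0" "c < 0"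
    by linarith
  then show ?thesis
  proof cases
    case 3
    then show ?thesis using opp[OF _ _ neg] by (simp add: F_uminus assms(1) extremal_uminus)
  next
    case 4
    then show ?thesis using same[OF _ _ neg] by (simp add: F_uminus assms(1) extremal_uminus)
  qed (use opp same assms(2) in auto)
qed

lemma extremal_iff_F:
  assumes "q \<le> p"
  shows "extremal a b c \<longleftrightarrow> (a, c) \<in> Pi_dom \<and> b = F m n a c"
proof
  assume e: "extremal a b c"
  have "(a, c) \<in> Pi_dom" using extremal_bounds[OF e] by (auto simp: Pi_dom_def)
  then show "(a, c) \<in> Pi_dom \<and> b = F m n a c"
    using extremal_unique[OF e extremal_F[OF assms]] by simp
qed (use extremal_F[OF assms] in auto)


section \<open>From profiles to the trinomial norm\<close>

lemma powr_pow:
  fixes x :: real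
  assumes "0 \<le> x"
  shows "(x ^ m) powr p = x ^ (m - n)" "(x ^ m) powr q = x ^ n"
proof -
  have m: "real m * p = real (m - n)" "real m * q = real n"
    using n_pos n_less by (simp_all add: p_eq q_eq)
  have "(x ^ m) powr p = x ^ (m - n) \<and> (x ^ m) powr q = x ^ n"
  proof (cases "x = 0")
    case True
    then show ?thesis using n_pos n_less by (simp add: zero_power)
  next
    case False
    then have "0 < x" using assms by simp
    then show ?thesis by (simp add: powr_realpow[symmetric] powr_powr m)
  qed
  then show "(x ^ m) powr p = x ^ (m - n)" "(x ^ m) powr q = x ^ n" by auto
qed

lemma tri_norm_attained:
  obtains x y where "x \<in> {-1..1}" "y \<in> {-1..1}"
    "tri_norm m n (a, b, c) = \<bar>a * x ^ m + b * x ^ (m - n) * y ^ n + c * y ^ m\<bar>"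
    "\<And>x y. x \<in> {-1..1} \<Longrightarrow> y \<in> {-1..1} \<Longrightarrow>
      \<bar>a * x ^ m + b * x ^ (m - n) * y ^ n + c * y ^ m\<bar> \<le> tri_norm m n (a, b, c)"
proof -
  define S :: "(real \<times> real) set" where "S = {-1..1} \<times> {-1..1}"
  define f where "f = (\<lambda>(x, y). \<bar>a * x ^ m + b * x ^ (m - n) * y ^ n + c * y ^ m\<bar>)"
  have "compact S" "S \<noteq> {}" by (auto simp: S_def intro!: compact_Times)
  moreover have "continuous_on S f"
    unfolding f_def case_prod_beta by (intro continuous_intros)
  ultimately obtain z where z: "z \<in> S" "\<And>w. w \<in> S \<Longrightarrow> f w \<le> f z"
    using continuous_attains_sup by meson
  have "tri_norm m n (a, b, c) = Sup (f ` S)" by (simp add: tri_norm_def f_def S_def)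
  also have "\<dots> = f z" using z by (intro cSup_eq_maximum) auto
  finally have "tri_norm m n (a, b, c) = f z" .
  with z that[of "fst z" "snd z"] show ?thesis by (force simp: f_def S_def case_prod_beta)
qed

lemma abs_trinomial_le_profile:
  assumes "even m"
  shows "\<bar>a * x ^ m + b * x ^ (m - n) * y ^ n + c * y ^ m\<bar>
    \<le> profile a \<bar>b\<bar> c (\<bar>x\<bar> ^ m) (\<bar>y\<bar> ^ m)"
proof -
  have "\<bar>a * x ^ m + b * x ^ (m - n) * y ^ n + c * y ^ m\<bar>
      \<le> \<bar>a * x ^ m + c * y ^ m\<bar> + \<bar>b * x ^ (m - n) * y ^ n\<bar>"
    by linarith
  also have "\<dots> = profile a \<bar>b\<bar> c (\<bar>x\<bar> ^ m) (\<bar>y\<bar> ^ m)"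
    using powr_pow[of "\<bar>x\<bar>"] powr_pow[of "\<bar>y\<bar>"] assms
    by (simp add: profile_def power_even_abs abs_mult power_abs mult.assoc)
  finally show ?thesis .
qed

text \<open>
  Since \<open>m\<close> is even and \<open>m - n\<close> is odd, flipping the sign of \<open>x\<close> flips only the middle term.
\<close>

lemma profile_attained:
  assumes "even m" "odd n" "X \<in> {0..1}" "Y \<in> {0..1}"
  obtains x y where "x \<in> {-1..1}" "y \<in> {-1..1}"
    "profile a \<bar>b\<bar> c X Y = \<bar>a * x ^ m + b * x ^ (m - n) * y ^ n + c * y ^ m\<bar>"
proof -
  define x y where "x = root m X" and "y = root m Y"
  have m: "0 < m" using n_less by simp
  have xy: "0 \<le> x" "x \<le> 1" "0 \<le> y" "y \<le> 1" "x ^ m = X" "y ^ m = Y"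
    using assms m by (auto simp: x_def y_def)
  define w where "w = b * x ^ (m - n) * y ^ n"
  have odd: "odd (m - n)" using assms n_less by simp
  have "\<bar>w\<bar> = \<bar>b\<bar> * (X powr p * Y powr q)"
    using powr_pow[of x] powr_pow[of y] xy by (simp add: w_def abs_mult mult.assoc)
  then have pr: "profile a \<bar>b\<bar> c X Y = \<bar>a * X + c * Y\<bar> + \<bar>w\<bar>" by (simp add: profile_def)
  then consider "profile a \<bar>b\<bar> c X Y = \<bar>a * X + w + c * Y\<bar>"
    | "profile a \<bar>b\<bar> c X Y = \<bar>a * X - w + c * Y\<bar>"
    by linarith
  then show ?thesis
  proof cases
    case 1
    then show ?thesis using that[of x y] xy by (simp add: w_def)
  next
    case 2
    then show ?thesis using that[of "- x" y] xy assms(1) odd by (simp add: w_def)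
  qed
qed

text \<open>The profile dominates the trinomial at a maximiser, and each profile value is an
  absolute value of the trinomial, so both have the same maximum.\<close>

lemma tri_norm_eq_1_iff:
  assumes "even m" "odd n"
  shows "tri_norm m n (a, b, c) = 1 \<longleftrightarrow> extremal a \<bar>b\<bar> c"
proof -
  define f where "f x y = \<bar>a * x ^ m + b * x ^ (m - n) * y ^ n + c * y ^ m\<bar>" for x y
  obtain x0 y0 where 0: "x0 \<in> {-1..1}" "y0 \<in> {-1..1}" "tri_norm m n (a, b, c) = f x0 y0"
    and max: "\<And>x y. x \<in> {-1..1} \<Longrightarrow> y \<in> {-1..1} \<Longrightarrow> f x y \<le> tri_norm m n (a, b, c)"
    using tri_norm_attained[of a b c] unfolding f_def by blast
  define X0 Y0 where "X0 = \<bar>x0\<bar> ^ m" and "Y0 = \<bar>y0\<bar> ^ m"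
  have X0: "X0 \<in> {0..1}" "Y0 \<in> {0..1}"
    using 0 by (auto simp: X0_def Y0_def intro!: power_le_one)
  have le: "tri_norm m n (a, b, c) \<le> profile a \<bar>b\<bar> c X0 Y0"
    unfolding 0(3) f_def X0_def Y0_def by (rule abs_trinomial_le_profile[OF assms(1)])
  have ge: "profile a \<bar>b\<bar> c X Y \<le> tri_norm m n (a, b, c)" if XY: "X \<in> {0..1}" "Y \<in> {0..1}" for X Y
    using profile_attained[OF assms XY, of a b c] max unfolding f_def by metis
  show ?thesis
  proof
    assume "tri_norm m n (a, b, c) = 1"
    then show "extremal a \<bar>b\<bar> c"
      using X0 le ge[OF X0] ge unfolding extremal_def by (metis abs_ge_zero antisym)
  next
    assume "extremal a \<bar>b\<bar> c"
    then show "tri_norm m n (a, b, c) = 1"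
      using X0 le ge unfolding extremal_def by (metis antisym)
  qed
qed

lemma unit_sphere_eq:
  assumes "even m" "odd n" "q \<le> p"
  shows "unit_sphere m n = graph_Pi (F m n) \<union> graph_Pi (\<lambda>a c. - F m n a c)"
proof -
  have "(a, b, c) \<in> unit_sphere m n \<longleftrightarrow>
      (a, b, c) \<in> graph_Pi (F m n) \<union> graph_Pi (\<lambda>a c. - F m n a c)" for a b c
  proof -
    \<comment> \<open>Nonnegativity lets \<open>\<bar>b\<bar> = F m n a c\<close> split into the two
      graphs.\<close>
    have "0 \<le> F m n a c" if "(a, c) \<in> Pi_dom"
      using extremal_F[OF assms(3) that] by (simp add: extremal_def)
    then show ?thesis
      by (auto simp: unit_sphere_def graph_Pi_def tri_norm_eq_1_iff[OF assms(1,2)]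
          extremal_iff_F[OF assms(3)] abs_if split: if_splits)
  qed
  then show ?thesis by auto
qed

end

section \<open>The two cases of the theorem\<close>

lemma trinomialI:
  assumes "0 < n" "n < m"
  shows "trinomial ((real m - real n) / real m) (real n / real m) m n"
  using assms by unfold_locales (auto simp: field_simps)

lemma unit_sphere_eq_graph_F:
  assumes "0 < n" "n < m" "even m" "odd n" "2 * n \<le> m"
  shows "unit_sphere m n = graph_Pi (F m n) \<union> graph_Pi (\<lambda>a c. - F m n a c)"
  using assms
  by (intro trinomial.unit_sphere_eq[OF trinomialI]) (auto intro!: divide_right_mono)

text \<open>Exchanging \<open>x\<close> and \<open>y\<close> preserves the square and replaces
  \<open>n\<close> by \<open>m - n\<close>.\<close>

lemma tri_norm_swap:
  assumes "n < m"
  shows "tri_norm m (m - n) (c, b, a) = tri_norm m n (a, b, c)"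
proof -
  define f where "f = (\<lambda>(x, y). \<bar>a * x ^ m + b * x ^ (m - n) * y ^ n + c * y ^ m\<bar>)"
  define S :: "(real \<times> real) set" where "S = {-1..1} \<times> {-1..1}"
  have "tri_norm m (m - n) (c, b, a) = Sup ((f \<circ> prod.swap) ` S)"
    using assms by (simp add: tri_norm_def f_def S_def o_def case_prod_beta' ac_simps)
  also have "(f \<circ> prod.swap) ` S = f ` S"
    unfolding image_comp[symmetric] S_def by (simp add: product_swap)
  also have "Sup (f ` S) = tri_norm m n (a, b, c)"
    by (simp add: tri_norm_def f_def S_def)
  finally show ?thesis .
qed

lemma graph_Pi_swap: "(a, b, c) \<in> graph_Pi (\<lambda>a c. f c a) \<longleftrightarrow> (c, b, a) \<in> graph_Pi f"
  by (auto simp: graph_Pi_def Pi_dom_def add.commute)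

theorem theorem3p4:
  fixes m n :: nat
  assumes "0 < n" and "n < m" and "even m" and "odd n"
  shows "(m \<ge> 2 * n \<longrightarrow>
            unit_sphere m n = graph_Pi (F m n) \<union> graph_Pi (\<lambda>a c. - F m n a c)) \<and>
         (m \<le> 2 * n \<longrightarrow>
            unit_sphere m n = graph_Pi (G m n) \<union> graph_Pi (\<lambda>a c. - G m n a c))"
proof (intro conjI impI)
  assume "m \<ge> 2 * n"
  then show "unit_sphere m n = graph_Pi (F m n) \<union> graph_Pi (\<lambda>a c. - F m n a c)"
    using assms by (intro unit_sphere_eq_graph_F)
next
  assume "m \<le> 2 * n"
  \<comment> \<open>\<open>m - n\<close> is again odd, and
    \<open>2 * (m - n) \<le> m\<close>.\<close>
  then have *: "unit_sphere m (m - n)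
      = graph_Pi (F m (m - n)) \<union> graph_Pi (\<lambda>a c. - F m (m - n) a c)"
    using assms by (intro unit_sphere_eq_graph_F) auto
  have "(a, b, c) \<in> unit_sphere m n \<longleftrightarrow>
      (a, b, c) \<in> graph_Pi (G m n) \<union> graph_Pi (\<lambda>a c. - G m n a c)" for a b c
  proof -
    have "(a, b, c) \<in> unit_sphere m n \<longleftrightarrow> (c, b, a) \<in> unit_sphere m (m - n)"
      using tri_norm_swap[OF assms(2)] by (simp add: unit_sphere_def)
    also have "\<dots> \<longleftrightarrow> (a, b, c) \<in> graph_Pi (G m n) \<union> graph_Pi (\<lambda>a c. - G m n a c)"
      unfolding * G_def using graph_Pi_swap[of a b c "F m (m - n)"]
        graph_Pi_swap[of a b c "\<lambda>a c. - F m (m - n) a c"] by auto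
    finally show ?thesis .
  qed
  then show "unit_sphere m n = graph_Pi (G m n) \<union> graph_Pi (\<lambda>a c. - G m n a c)"
    by auto
qed

end
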